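(* Let $\mathfrak g$ be a non-simply-laced simple Lie algebra. A family of functions $\{\mathcal Q_{\alpha,i}(\mathbf u)\mid\alpha\in I_r,i\in\mathbb Z_{\ge0}\}$ satisfies the $\mathcal Q$-system $$\mathcal Q_{\alpha,0}=1,\quad\mathcal Q_{\alpha,1}=u_\alpha^{-1},\quad\mathcal Q_{\alpha,i+1}=\frac{\mathcal Q_{\alpha,i}^2-\prod_{\beta\sim\alpha}\mathcal T_i^{(\alpha,\beta)}}{u_{\alpha,i}\mathcal Q_{\alpha,i-1}}\quad(i\ge1,\ \alpha\in I_r)$$ if and only if it satisfies the recursion relation $$\mathcal Q_{\alpha,i+t_\alpha}(\mathbf u)=\mathcal Q_{\alpha,i}(\mathbf u'),\qquad i\ge1,\ \alpha\in I_r,$$ subject to the initial conditions that the $\mathcal Q_{\alpha,j}$ with $0\le j\le t_\alpha+1$ are those defined by the $\mathcal Q$-system, where the substituted variables $\mathbf u'$ are $$u'_\alpha=\frac1{\mathcal Q_{\alpha,t_\alpha+1}(\mathbf u)},\qquad u'_{\alpha,j}=\mathcal Q_{\alpha,t_\alpha}(\mathbf u)^{\delta_{j,1}}\,u_{\alpha,t_\alpha+j},\qquad a'_i=\mathcal Q_{\gamma,1}(\mathbf u)^{\delta_{i<t_{\gamma'}}}\,a_{i+t_{\gamma'}}.$$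
   Context: $\mathfrak g$ is $B_r$, $C_r$, $F_4$ or $G_2$; $I_r=\{1,\dots,r\}$ indexes simple roots; $\beta\sim\alpha$ means adjacency in the Dynkin diagram. $t_\alpha=1$ for long simple roots, $t_\alpha=2$ for short simple roots of $B_r,C_r,F_4$, $t_\alpha=3$ for the short simple root of $G_2$. $\gamma$ (long) and $\gamma'$ (short) are the adjacent simple roots of different lengths: $\gamma=r-1,r,2,1$ and $\gamma'=r,r-1,3,2$ for $B_r,C_r,F_4,G_2$ respectively. $\delta_{i<j}$ is $1$ if $i<j$ and $0$ otherwise. Formal variables $\mathbf u=\{u_\alpha,u_{\alpha,j},a_j\mid\alpha\in I_r,j\ge1\}$; the functions are rational functions of these. The functions $\mathcal T$ are: $\mathcal T^{(\alpha,\beta)}_i=\mathcal Q_{\beta,i}$ if $t_\alpha=t_\beta$; $\ \mathcal T_i^{(\gamma,\gamma')}=\mathcal Q_{\gamma',t_{\gamma'}i}$; and $$\mathcal T_i^{(\gamma',\gamma)}=a_i^{\,(-i)\bmod t_{\gamma'}}\prod_{s=0}^{t_{\gamma'}-1}\mathcal Q_{\gamma,\lfloor (i+s)/t_{\gamma'}\rfloor},$$ residues mod $t_{\gamma'}$ being taken in $\{0,\dots,t_{\gamma'}-1\}$. *)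

theory Defs
  imports
    "HOL-Library.Poly_Mapping"
    "HOL-Library.Nat_Bijection"
    "HOL-Computational_Algebra.Fraction_Field"
begin

section \<open>Rational functions and substitution\<close>

text \<open>Polynomials in indeterminates \<open>'v\<close> are finitely supported functions from monomials
  \<open>'v \<Rightarrow>\<^sub>0 nat\<close> to coefficients.  The linear order on \<open>'v\<close> serves only to make the library
  recognise this ring as an integral domain.\<close>

type_synonym ('v, 'k) mpoly = "('v \<Rightarrow>\<^sub>0 nat) \<Rightarrow>\<^sub>0 'k"
type_synonym ('v, 'k) ratfun = "(('v, 'k) mpoly) fract"

definition indet :: "'v::linorder \<Rightarrow> ('v, 'k::field) ratfun" where
  "indet v = Fract (Poly_Mapping.single (Poly_Mapping.single v 1) 1) 1"

definition const_ratfun :: "'k::field \<Rightarrow> ('v::linorder, 'k) ratfun" where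
  "const_ratfun c = Fract (Poly_Mapping.single 0 c) 1"

definition mpoly_subst ::
    "('v::linorder \<Rightarrow> ('v, 'k::field) ratfun) \<Rightarrow> ('v, 'k) mpoly \<Rightarrow> ('v, 'k) ratfun" where
  "mpoly_subst \<sigma> p =
     (\<Sum>m\<in>Poly_Mapping.keys p. const_ratfun (Poly_Mapping.lookup p m) *
        (\<Prod>v\<in>Poly_Mapping.keys m. \<sigma> v ^ Poly_Mapping.lookup m v))"

text \<open>The substitution \<open>f(\<sigma>)\<close> is computed from any presentation of \<open>f\<close> as a quotient whose
  denominator stays nonzero under \<open>\<sigma>\<close>.  The value does not depend on the presentation: see
  \<open>ratfun_subst_Fract\<close> below.\<close>

definition ratfun_subst ::
    "('v::linorder \<Rightarrow> ('v, 'k::field) ratfun) \<Rightarrow> ('v, 'k) ratfun \<Rightarrow> ('v, 'k) ratfun" where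
  "ratfun_subst \<sigma> f =
     (THE g. \<exists>p q. f = Fract p q \<and> mpoly_subst \<sigma> q \<noteq> 0 \<and> g = mpoly_subst \<sigma> p / mpoly_subst \<sigma> q)"

definition mpoly_vars :: "('v, 'k::zero) mpoly \<Rightarrow> 'v set" where
  "mpoly_vars p = (\<Union>m\<in>Poly_Mapping.keys p. Poly_Mapping.keys m)"

definition ratfuns_in :: "'v::linorder set \<Rightarrow> ('v, 'k::field) ratfun set" where
  "ratfuns_in V = {Fract p q | p q. q \<noteq> 0 \<and> mpoly_vars p \<subseteq> V \<and> mpoly_vars q \<subseteq> V}"

lemma const_ratfun_add: "const_ratfun (a + b) = const_ratfun a + const_ratfun b"
  and const_ratfun_mult: "const_ratfun (a * b) = const_ratfun a * const_ratfun b"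
  and const_ratfun_0: "const_ratfun 0 = 0"
  by (simp_all add: const_ratfun_def single_add mult_single Zero_fract_def)

lemma monomial_subst_superset:
  assumes "finite S" "Poly_Mapping.keys m \<subseteq> S"
  shows "(\<Prod>v\<in>Poly_Mapping.keys m. \<sigma> v ^ Poly_Mapping.lookup m v) =
         (\<Prod>v\<in>S. (\<sigma> v :: ('v::linorder, 'k::field) ratfun) ^ Poly_Mapping.lookup m v)"
  using assms by (intro prod.mono_neutral_left) (auto simp: in_keys_iff)

lemma monomial_subst_add:
  fixes \<sigma> :: "'v::linorder \<Rightarrow> ('v, 'k::field) ratfun"
  shows "(\<Prod>v\<in>Poly_Mapping.keys (m + n). \<sigma> v ^ Poly_Mapping.lookup (m + n) v) =
     (\<Prod>v\<in>Poly_Mapping.keys m. \<sigma> v ^ Poly_Mapping.lookup m v) *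
     (\<Prod>v\<in>Poly_Mapping.keys n. \<sigma> v ^ Poly_Mapping.lookup n v)"
proof -
  let ?S = "Poly_Mapping.keys m \<union> Poly_Mapping.keys n"
  have "Poly_Mapping.keys (m + n) \<subseteq> ?S" by (rule keys_add)
  then show ?thesis
    by (subst (1 2 3) monomial_subst_superset[of ?S])
      (simp_all add: lookup_add power_add prod.distrib)
qed

lemma mpoly_subst_superset:
  assumes "finite S" "Poly_Mapping.keys p \<subseteq> S"
  shows "mpoly_subst \<sigma> p = (\<Sum>m\<in>S. const_ratfun (Poly_Mapping.lookup p m) *
           (\<Prod>v\<in>Poly_Mapping.keys m. \<sigma> v ^ Poly_Mapping.lookup m v))"
  unfolding mpoly_subst_def using assms
  by (intro sum.mono_neutral_left) (auto simp: in_keys_iff const_ratfun_0)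

lemma mpoly_subst_0: "mpoly_subst \<sigma> 0 = 0"
  by (simp add: mpoly_subst_def)

lemma mpoly_subst_add: "mpoly_subst \<sigma> (p + q) = mpoly_subst \<sigma> p + mpoly_subst \<sigma> q"
proof -
  let ?S = "Poly_Mapping.keys p \<union> Poly_Mapping.keys q"
  have "Poly_Mapping.keys (p + q) \<subseteq> ?S" by (rule keys_add)
  then show ?thesis
    by (simp add: mpoly_subst_superset[of ?S] lookup_add const_ratfun_add distrib_right sum.distrib)
qed

lemma mpoly_subst_single: "mpoly_subst \<sigma> (Poly_Mapping.single m c) =
    const_ratfun c * (\<Prod>v\<in>Poly_Mapping.keys m. \<sigma> v ^ Poly_Mapping.lookup m v)"
  by (simp add: mpoly_subst_superset[of "{m}"])

lemma mpoly_induct [case_names zero add]: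
  fixes p :: "('v, 'k::comm_monoid_add) mpoly"
  assumes "P 0" "\<And>p m c. P p \<Longrightarrow> P (p + Poly_Mapping.single m c)"
  shows "P p"
proof (induction p rule: update_induct)
  case const
  show ?case using assms(1) by simp
next
  case (update p m c)
  have "Poly_Mapping.update m c p = p + Poly_Mapping.single m c"
    using update(1) by (intro poly_mapping_eqI)
      (auto simp: lookup_update lookup_add lookup_single when_def in_keys_iff)
  then show ?case using assms(2) update by metis
qed

lemma mpoly_subst_mult: "mpoly_subst \<sigma> (p * q) = mpoly_subst \<sigma> p * mpoly_subst \<sigma> q"
proof -
  have mono: "mpoly_subst \<sigma> (p * Poly_Mapping.single m c) =
      mpoly_subst \<sigma> p * mpoly_subst \<sigma> (Poly_Mapping.single m c)" for p m c
  proof (induction p rule: mpoly_induct)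
    case (add p m' c')
    have "mpoly_subst \<sigma> (Poly_Mapping.single m' c' * Poly_Mapping.single m c) =
        mpoly_subst \<sigma> (Poly_Mapping.single m' c') * mpoly_subst \<sigma> (Poly_Mapping.single m c)"
      by (simp add: mult_single mpoly_subst_single monomial_subst_add const_ratfun_mult mult_ac)
    with add show ?case by (simp only: distrib_right mpoly_subst_add)
  qed (simp add: mpoly_subst_0)
  show ?thesis
    by (induction q rule: mpoly_induct)
      (simp_all add: mpoly_subst_0 mpoly_subst_add distrib_left mono)
qed

lemma ratfun_subst_Fract:
  assumes "mpoly_subst \<sigma> q \<noteq> 0"
  shows "ratfun_subst \<sigma> (Fract p q) = mpoly_subst \<sigma> p / mpoly_subst \<sigma> q"
  unfolding ratfun_subst_def
proof (rule the_equality)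
  fix g
  assume "\<exists>p' q'. Fract p q = Fract p' q' \<and> mpoly_subst \<sigma> q' \<noteq> 0 \<and>
            g = mpoly_subst \<sigma> p' / mpoly_subst \<sigma> q'"
  then obtain p' q' where eq: "Fract p q = Fract p' q'" and nz: "mpoly_subst \<sigma> q' \<noteq> 0"
    and g: "g = mpoly_subst \<sigma> p' / mpoly_subst \<sigma> q'" by blast
  have "q \<noteq> 0" "q' \<noteq> 0" using assms nz by (auto simp: mpoly_subst_0)
  with eq have "p * q' = p' * q" by (simp add: eq_fract)
  then have "mpoly_subst \<sigma> p * mpoly_subst \<sigma> q' = mpoly_subst \<sigma> p' * mpoly_subst \<sigma> q"
    by (metis mpoly_subst_mult)
  then show "g = mpoly_subst \<sigma> p / mpoly_subst \<sigma> q"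
    using assms nz by (simp add: g frac_eq_eq)
qed (use assms in blast)


section \<open>Dynkin data of the non-simply-laced types\<close>

datatype nsl_type = Type_B nat | Type_C nat | Type_F4 | Type_G2

text \<open>\<open>B\<^sub>1\<close> and \<open>C\<^sub>1\<close> are simply laced, hence excluded.\<close>

fun valid_type :: "nsl_type \<Rightarrow> bool" where
  "valid_type (Type_B r) \<longleftrightarrow> r \<ge> 2"
| "valid_type (Type_C r) \<longleftrightarrow> r \<ge> 2"
| "valid_type Type_F4 \<longleftrightarrow> True"
| "valid_type Type_G2 \<longleftrightarrow> True"

fun rank :: "nsl_type \<Rightarrow> nat" where
  "rank (Type_B r) = r"
| "rank (Type_C r) = r"
| "rank Type_F4 = 4"
| "rank Type_G2 = 2"

definition simple_roots :: "nsl_type \<Rightarrow> nat set" where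
  "simple_roots X = {1..rank X}"

text \<open>In the Bourbaki labelling all these Dynkin diagrams are paths \<open>1 - 2 - \<dots> - r\<close>
  once edge multiplicities are ignored.\<close>

definition adjacent :: "nsl_type \<Rightarrow> nat \<Rightarrow> nat \<Rightarrow> bool" where
  "adjacent X \<alpha> \<beta> \<longleftrightarrow>
     \<alpha> \<in> simple_roots X \<and> \<beta> \<in> simple_roots X \<and> (\<beta> = \<alpha> + 1 \<or> \<alpha> = \<beta> + 1)"

fun t_root :: "nsl_type \<Rightarrow> nat \<Rightarrow> nat" where
  "t_root (Type_B r) \<alpha> = (if \<alpha> = r then 2 else 1)"
| "t_root (Type_C r) \<alpha> = (if \<alpha> = r then 1 else 2)"
| "t_root Type_F4 \<alpha> = (if \<alpha> \<le> 2 then 1 else 2)"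
| "t_root Type_G2 \<alpha> = (if \<alpha> = 1 then 1 else 3)"

fun long_root :: "nsl_type \<Rightarrow> nat" where
  "long_root (Type_B r) = r - 1"
| "long_root (Type_C r) = r"
| "long_root Type_F4 = 2"
| "long_root Type_G2 = 1"

fun short_root :: "nsl_type \<Rightarrow> nat" where
  "short_root (Type_B r) = r"
| "short_root (Type_C r) = r - 1"
| "short_root Type_F4 = 3"
| "short_root Type_G2 = 2"


section \<open>The Q-system with formal variables\<close>

text \<open>\<open>Var_u \<alpha>\<close>, \<open>Var_uj \<alpha> j\<close> and \<open>Var_a j\<close> stand for \<open>u\<^sub>\<alpha>\<close>, \<open>u\<^bsub>\<alpha>,j\<^esub>\<close> and \<open>a\<^sub>j\<close>.  The type also
  contains surplus symbols (\<open>\<alpha>\<close> not a simple root, or \<open>j = 0\<close>); the variables of the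
  Q-system are those in \<open>formal_vars\<close>.\<close>

datatype var = Var_u nat | Var_uj nat nat | Var_a nat

fun var_code :: "var \<Rightarrow> nat" where
  "var_code (Var_u \<alpha>) = 3 * \<alpha>"
| "var_code (Var_uj \<alpha> j) = 3 * prod_encode (\<alpha>, j) + 1"
| "var_code (Var_a j) = 3 * j + 2"

lemma var_code_inj: "var_code v = var_code w \<Longrightarrow> v = w"
  by (cases v; cases w; simp; presburger)

instantiation var :: linorder
begin

definition less_eq_var :: "var \<Rightarrow> var \<Rightarrow> bool" where
  "v \<le> w \<longleftrightarrow> var_code v \<le> var_code w"

definition less_var :: "var \<Rightarrow> var \<Rightarrow> bool" where
  "v < w \<longleftrightarrow> var_code v < var_code w"

instance
  by standard (auto simp: less_eq_var_def less_var_def intro: var_code_inj)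

end

definition formal_vars :: "nsl_type \<Rightarrow> var set" where
  "formal_vars X =
     {Var_u \<alpha> | \<alpha>. \<alpha> \<in> simple_roots X} \<union> {Var_uj \<alpha> j | \<alpha> j. \<alpha> \<in> simple_roots X \<and> j \<ge> 1} \<union> {Var_a j | j. j \<ge> 1}"

type_synonym 'k family = "nat \<Rightarrow> nat \<Rightarrow> (var, 'k) ratfun"

text \<open>\<open>T_fun X Q \<alpha> \<beta> i\<close> is meant for adjacent \<open>\<alpha>\<close>, \<open>\<beta>\<close>; if their lengths differ, then
  \<open>(\<alpha>, \<beta>)\<close> is either \<open>(\<gamma>, \<gamma>')\<close> or \<open>(\<gamma>', \<gamma>)\<close>, the latter being the last branch.\<close>

definition T_fun :: "nsl_type \<Rightarrow> 'k::field family \<Rightarrow> nat \<Rightarrow> nat \<Rightarrow> nat \<Rightarrow> (var, 'k) ratfun" where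
  "T_fun X Q \<alpha> \<beta> i =
     (let \<gamma> = long_root X; \<gamma>' = short_root X; d = t_root X \<gamma>' in
      if t_root X \<alpha> = t_root X \<beta> then Q \<beta> i
      else if \<alpha> = \<gamma> \<and> \<beta> = \<gamma>' then Q \<gamma>' (d * i)
      else indet (Var_a i) ^ nat ((- int i) mod int d) * (\<Prod>s = 0..d - 1. Q \<gamma> ((i + s) div d)))"

definition Q_relation :: "nsl_type \<Rightarrow> 'k::field family \<Rightarrow> nat \<Rightarrow> nat \<Rightarrow> bool" where
  "Q_relation X Q \<alpha> i \<longleftrightarrow>
     Q \<alpha> (i + 1) = ((Q \<alpha> i)\<^sup>2 - (\<Prod>\<beta> | adjacent X \<alpha> \<beta>. T_fun X Q \<alpha> \<beta> i)) / (indet (Var_uj \<alpha> i) * Q \<alpha> (i - 1))"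

definition Q_system :: "nsl_type \<Rightarrow> 'k::field family \<Rightarrow> bool" where
  "Q_system X Q \<longleftrightarrow>
     (\<forall>\<alpha>\<in>simple_roots X. Q \<alpha> 0 = 1 \<and> Q \<alpha> 1 = inverse (indet (Var_u \<alpha>)) \<and>
        (\<forall>i\<ge>1. Q_relation X Q \<alpha> i))"

text \<open>The part of the Q-system that determines \<open>Q \<alpha> j\<close> for \<open>0 \<le> j \<le> t_root X \<alpha> + 1\<close>.  It is
  self-contained: for \<open>1 \<le> i \<le> t_root X \<alpha>\<close> the factors \<open>T_fun X Q \<alpha> \<beta> i\<close> involve only members
  \<open>Q \<beta> j\<close> with \<open>j \<le> t_root X \<beta>\<close>.\<close>

definition Q_initial :: "nsl_type \<Rightarrow> 'k::field family \<Rightarrow> bool" where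
  "Q_initial X Q \<longleftrightarrow>
     (\<forall>\<alpha>\<in>simple_roots X. Q \<alpha> 0 = 1 \<and> Q \<alpha> 1 = inverse (indet (Var_u \<alpha>)) \<and>
        (\<forall>i. 1 \<le> i \<and> i \<le> t_root X \<alpha> \<longrightarrow> Q_relation X Q \<alpha> i))"

fun shifted :: "nsl_type \<Rightarrow> 'k::field family \<Rightarrow> var \<Rightarrow> (var, 'k) ratfun" where
  "shifted X Q (Var_u \<alpha>) = 1 / Q \<alpha> (t_root X \<alpha> + 1)"
| "shifted X Q (Var_uj \<alpha> j) = Q \<alpha> (t_root X \<alpha>) ^ of_bool (j = 1) * indet (Var_uj \<alpha> (t_root X \<alpha> + j))"
| "shifted X Q (Var_a i) =
     Q (long_root X) 1 ^ of_bool (i < t_root X (short_root X)) * indet (Var_a (i + t_root X (short_root X)))"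

definition Q_recursion :: "nsl_type \<Rightarrow> 'k::field family \<Rightarrow> bool" where
  "Q_recursion X Q \<longleftrightarrow>
     (\<forall>\<alpha>\<in>simple_roots X. \<forall>i\<ge>1. Q \<alpha> (i + t_root X \<alpha>) = ratfun_subst (shifted X Q) (Q \<alpha> i))"

end

theory Submission
  imports Defs
begin

text \<open>The substitution \<open>u'\<close> sends each variable to a nonzero multiple of a different variable, the
  factors lying in the field generated by the finitely many variables \<open>u\<^sub>\<alpha>\<close>, \<open>u\<^bsub>\<alpha>,j\<^esub>\<close> (\<open>j < t\<^sub>\<alpha>\<close>),
  \<open>a\<^sub>j\<close> (\<open>j < t\<^bsub>\<gamma>'\<^esub>\<close>) that are no longer hit.  The images are therefore algebraically independent, so the
  substitution is an endomorphism of the field of rational functions and division needs no further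
  care.  It maps the relation for \<open>Q\<^bsub>\<alpha>,i+1\<^esub>\<close> to the one for \<open>Q\<^bsub>\<alpha>,i+1+t\<^esub>\<close>, where \<open>t = t\<^sub>\<alpha>\<close>, and both
  directions follow by induction.  That the factors do not vanish is a statement about the initial
  members only: in \<open>Q\<^bsub>\<alpha>,i\<^esub>\<^sup>2 - \<Prod> T\<^sub>i\<close> one of the two terms is a nonzero multiple of a nonzero power of
  some variable that otherwise does not occur.\<close>

section \<open>Rational functions in a set of variables\<close>

lemma mpoly_vars_add: "mpoly_vars (p + q) \<subseteq> mpoly_vars p \<union> mpoly_vars q"
  using keys_add[of p q] by (auto simp: mpoly_vars_def)

lemma mpoly_vars_mult: "mpoly_vars (p * q) \<subseteq> mpoly_vars p \<union> mpoly_vars q"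
proof
  fix v assume "v \<in> mpoly_vars (p * q)"
  then obtain m where m: "m \<in> Poly_Mapping.keys (p * q)" and v: "v \<in> Poly_Mapping.keys m"
    by (auto simp: mpoly_vars_def)
  from m keys_mult[of p q] obtain a b where "a \<in> Poly_Mapping.keys p" "b \<in> Poly_Mapping.keys q"
    and "m = a + b" by blast
  with v keys_add[of a b] show "v \<in> mpoly_vars p \<union> mpoly_vars q"
    by (auto simp: mpoly_vars_def)
qed

lemma mpoly_vars_single: "mpoly_vars (Poly_Mapping.single m c) \<subseteq> Poly_Mapping.keys m"
  by (auto simp: mpoly_vars_def split: if_splits)

lemma mpoly_vars_uminus: "mpoly_vars (- p) = mpoly_vars (p :: ('v, 'k::ab_group_add) mpoly)"
  by (simp add: mpoly_vars_def in_keys_iff set_eq_iff)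

lemma mpoly_vars_0: "mpoly_vars 0 = {}"
  by (simp add: mpoly_vars_def)

lemma mpoly_vars_1: "mpoly_vars (1 :: ('v, 'k::zero_neq_one) mpoly) = {}"
  by (simp add: mpoly_vars_def)

lemma ratfuns_inI:
  "q \<noteq> 0 \<Longrightarrow> mpoly_vars p \<subseteq> V \<Longrightarrow> mpoly_vars q \<subseteq> V \<Longrightarrow> Fract p q \<in> ratfuns_in V"
  unfolding ratfuns_in_def by blast

lemma ratfuns_inE:
  assumes "f \<in> ratfuns_in V"
  obtains p q where "f = Fract p q" "q \<noteq> 0" "mpoly_vars p \<subseteq> V" "mpoly_vars q \<subseteq> V"
  using assms unfolding ratfuns_in_def by blast

lemma ratfuns_in_mono: "f \<in> ratfuns_in V \<Longrightarrow> V \<subseteq> W \<Longrightarrow> f \<in> ratfuns_in W"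
  unfolding ratfuns_in_def by blast

lemma ratfuns_in_0: "0 \<in> ratfuns_in V"
  and ratfuns_in_1: "1 \<in> ratfuns_in V"
  unfolding Zero_fract_def One_fract_def
  by (auto intro!: ratfuns_inI simp: mpoly_vars_0 mpoly_vars_1)

lemma ratfuns_in_indet: "v \<in> V \<Longrightarrow> indet v \<in> ratfuns_in V"
  unfolding indet_def
  by (intro ratfuns_inI order_trans[OF mpoly_vars_single]) (auto simp: mpoly_vars_1)

lemma ratfuns_in_mult:
  assumes "f \<in> ratfuns_in V" "g \<in> ratfuns_in V"
  shows "f * g \<in> ratfuns_in V"
proof -
  obtain p q r s where fg: "f = Fract p q" "g = Fract r s" and "q \<noteq> 0" "s \<noteq> 0"
    and "mpoly_vars p \<subseteq> V" "mpoly_vars q \<subseteq> V" "mpoly_vars r \<subseteq> V" "mpoly_vars s \<subseteq> V"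
    using assms by (elim ratfuns_inE)
  then show ?thesis unfolding fg mult_fract
    by (intro ratfuns_inI order_trans[OF mpoly_vars_mult]) auto
qed

lemma ratfuns_in_uminus: "f \<in> ratfuns_in V \<Longrightarrow> - f \<in> ratfuns_in V"
  by (elim ratfuns_inE) (auto intro!: ratfuns_inI simp: mpoly_vars_uminus)

lemma ratfuns_in_add:
  assumes "f \<in> ratfuns_in V" "g \<in> ratfuns_in V"
  shows "f + g \<in> ratfuns_in V"
proof -
  obtain p q r s where fg: "f = Fract p q" "g = Fract r s" and nz: "q \<noteq> 0" "s \<noteq> 0"
    and "mpoly_vars p \<subseteq> V" "mpoly_vars q \<subseteq> V" "mpoly_vars r \<subseteq> V" "mpoly_vars s \<subseteq> V"
    using assms by (elim ratfuns_inE)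
  then show ?thesis unfolding fg add_fract[OF nz]
    by (intro ratfuns_inI order_trans[OF mpoly_vars_add] order_trans[OF mpoly_vars_mult] Un_least)
      auto
qed

lemma ratfuns_in_diff: "f \<in> ratfuns_in V \<Longrightarrow> g \<in> ratfuns_in V \<Longrightarrow> f - g \<in> ratfuns_in V"
  using ratfuns_in_add[of f V "- g"] by (simp add: ratfuns_in_uminus)

lemma ratfuns_in_inverse:
  assumes "f \<in> ratfuns_in V"
  shows "inverse f \<in> ratfuns_in V"
proof (cases "f = 0")
  case False
  from assms obtain p q where f: "f = Fract p q" and "q \<noteq> 0" "mpoly_vars p \<subseteq> V" "mpoly_vars q \<subseteq> V"
    by (elim ratfuns_inE)
  moreover from f False have "p \<noteq> 0" by (auto simp: fract_collapse)
  ultimately show ?thesis by (auto intro!: ratfuns_inI)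
qed (simp add: ratfuns_in_0)

lemma ratfuns_in_divide: "f \<in> ratfuns_in V \<Longrightarrow> g \<in> ratfuns_in V \<Longrightarrow> f / g \<in> ratfuns_in V"
  by (simp add: divide_inverse ratfuns_in_mult ratfuns_in_inverse)

lemma ratfuns_in_power: "f \<in> ratfuns_in V \<Longrightarrow> f ^ n \<in> ratfuns_in V"
  by (induction n) (simp_all add: ratfuns_in_1 ratfuns_in_mult)

lemma ratfuns_in_prod: "(\<And>x. x \<in> A \<Longrightarrow> f x \<in> ratfuns_in V) \<Longrightarrow> (\<Prod>x\<in>A. f x) \<in> ratfuns_in V"
  by (induction A rule: infinite_finite_induct) (auto simp: ratfuns_in_1 ratfuns_in_mult)


section \<open>Monomials over a field of rational functions\<close>

definition mono_ratfun :: "('v::linorder \<Rightarrow>\<^sub>0 nat) \<Rightarrow> ('v, 'k::field) ratfun" where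
  "mono_ratfun m = Fract (Poly_Mapping.single m 1) 1"

lemma mono_ratfun_0: "mono_ratfun 0 = 1"
  by (simp add: mono_ratfun_def One_fract_def)

lemma mono_ratfun_add: "mono_ratfun (m + n) = mono_ratfun m * mono_ratfun n"
  by (simp add: mono_ratfun_def mult_single)

lemma mono_ratfun_sum: "mono_ratfun (\<Sum>x\<in>A. f x) = (\<Prod>x\<in>A. mono_ratfun (f x))"
  by (induction A rule: infinite_finite_induct) (simp_all add: mono_ratfun_0 mono_ratfun_add)

lemma indet_power: "indet v ^ n = mono_ratfun (Poly_Mapping.single v n)"
proof (induction n)
  case (Suc n)
  have "indet v * mono_ratfun (Poly_Mapping.single v n) =
      mono_ratfun (Poly_Mapping.single v 1 + Poly_Mapping.single v n)"
    by (simp add: mono_ratfun_add) (simp add: mono_ratfun_def indet_def)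
  with Suc show ?case by (simp flip: single_add)
qed (simp add: mono_ratfun_0)

text \<open>Exponents can be cancelled, so multiplying by a monomial merely translates the
  coefficients.\<close>

lemma lookup_mult_single:
  fixes p :: "('v, 'k::comm_semiring_1) mpoly"
  shows "Poly_Mapping.lookup (p * Poly_Mapping.single e 1) (k + e) = Poly_Mapping.lookup p k"
  by (induction p rule: mpoly_induct)
    (auto simp: distrib_right lookup_add mult_single lookup_single when_def)

text \<open>Clearing denominators inside the variables of \<open>V\<close> reduces
  \<open>monomials_independent\<close> to comparing coefficients of polynomials.\<close>

lemma common_denominator:
  assumes "finite S" "\<And>m. m \<in> S \<Longrightarrow> c m \<in> ratfuns_in V"
  shows "\<exists>D p. D \<noteq> 0 \<and> mpoly_vars D \<subseteq> V \<and>
    (\<forall>m\<in>S. mpoly_vars (p m) \<subseteq> V \<and> c m * Fract D 1 = Fract (p m) 1)"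
  using assms
proof (induction S rule: finite_induct)
  case empty
  show ?case by (intro exI[of _ 1]) (simp add: mpoly_vars_1)
next
  case (insert x S)
  have "\<And>m. m \<in> S \<Longrightarrow> c m \<in> ratfuns_in V" using insert.prems by simp
  from insert.IH[OF this] obtain D p where D: "D \<noteq> 0" "mpoly_vars D \<subseteq> V"
    and p: "\<And>m. m \<in> S \<Longrightarrow> mpoly_vars (p m) \<subseteq> V \<and> c m * Fract D 1 = Fract (p m) 1"
    by blast
  from insert.prems[of x] obtain a b where ab: "c x = Fract a b" "b \<noteq> 0"
    "mpoly_vars a \<subseteq> V" "mpoly_vars b \<subseteq> V" by (auto elim: ratfuns_inE)
  define p' where "p' m = (if m = x then a * D else p m * b)" for m
  have "c m * Fract (D * b) 1 = Fract (p' m) 1" if "m \<in> insert x S" for m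
  proof (cases "m = x")
    case True
    then show ?thesis using ab D by (simp add: p'_def eq_fract mult_ac)
  next
    case False
    have "c m * Fract (D * b) 1 = c m * Fract D 1 * Fract b 1" by (simp add: mult.assoc)
    also have "\<dots> = Fract (p m) 1 * Fract b 1" using False that p[of m] by simp
    finally show ?thesis using False by (simp add: p'_def)
  qed
  moreover have "mpoly_vars (p' m) \<subseteq> V" if "m \<in> insert x S" for m
    unfolding p'_def using ab D p[of m] that
    by (auto intro!: order_trans[OF mpoly_vars_mult])
  moreover have "D * b \<noteq> 0" "mpoly_vars (D * b) \<subseteq> V"
    using D ab mpoly_vars_mult[of D b] by auto
  ultimately show ?case by (intro exI[of _ "D * b"] exI[of _ p']) auto
qed

lemma Fract_sum_1: "(\<Sum>x\<in>A. Fract (f x) 1) = Fract (\<Sum>x\<in>A. f x) (1::'a::idom)"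
  by (induction A rule: infinite_finite_induct) (simp_all add: Zero_fract_def)

text \<open>A monomial splits uniquely into a factor in the variables of \<open>V\<close> and a
  factor in the others. After clearing denominators, a monomial with second factor
  \<open>e m0\<close> can only come from the summand \<open>m0\<close>, since \<open>e\<close> is
  injective.\<close>

lemma monomials_independent:
  assumes "finite S" and c: "\<And>m. m \<in> S \<Longrightarrow> c m \<in> ratfuns_in V"
    and e: "\<And>m. m \<in> S \<Longrightarrow> Poly_Mapping.keys (e m) \<inter> V = {}" and inj: "inj_on e S"
    and zero: "(\<Sum>m\<in>S. c m * mono_ratfun (e m)) = 0" and m0: "m0 \<in> S"
  shows "c m0 = 0"
proof -
  obtain D p where D: "D \<noteq> 0" and p: "\<And>m. m \<in> S \<Longrightarrow> mpoly_vars (p m) \<subseteq> V"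
    and cp: "\<And>m. m \<in> S \<Longrightarrow> c m * Fract D 1 = Fract (p m) 1"
    using common_denominator[of S c V, OF \<open>finite S\<close> c] by blast
  have "0 = (\<Sum>m\<in>S. c m * mono_ratfun (e m)) * Fract D 1" by (simp add: zero)
  also have "\<dots> = (\<Sum>m\<in>S. (c m * Fract D 1) * mono_ratfun (e m))"
    by (simp add: sum_distrib_left mult_ac)
  also have "\<dots> = Fract (\<Sum>m\<in>S. p m * Poly_Mapping.single (e m) 1) 1"
    by (simp add: cp mono_ratfun_def flip: Fract_sum_1)
  finally have sum0: "(\<Sum>m\<in>S. p m * Poly_Mapping.single (e m) 1) = 0"
    by (simp add: Zero_fract_def eq_fract)
  have "Poly_Mapping.lookup (p m0) k = 0" for k
  proof (cases "k \<in> Poly_Mapping.keys (p m0)")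
    case True
    have kV: "Poly_Mapping.keys k \<subseteq> V" using True p[OF m0] by (auto simp: mpoly_vars_def)
    have "Poly_Mapping.lookup (p m * Poly_Mapping.single (e m) 1) (k + e m0) = 0"
      if m: "m \<in> S" "m \<noteq> m0" for m
    proof (rule ccontr)
      assume "Poly_Mapping.lookup (p m * Poly_Mapping.single (e m) 1) (k + e m0) \<noteq> 0"
      then have "k + e m0 \<in> Poly_Mapping.keys (p m * Poly_Mapping.single (e m) 1)"
        by (simp add: in_keys_iff)
      then obtain a where a: "a \<in> Poly_Mapping.keys (p m)" "k + e m0 = a + e m"
        using keys_mult[of "p m" "Poly_Mapping.single (e m) 1"] by auto
      have aV: "Poly_Mapping.keys a \<subseteq> V" using a p[OF m(1)] by (auto simp: mpoly_vars_def)
      have "Poly_Mapping.lookup (e m0) v = Poly_Mapping.lookup (e m) v" for v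
      proof (cases "v \<in> V")
        case True
        then have "v \<notin> Poly_Mapping.keys (e m0)" "v \<notin> Poly_Mapping.keys (e m)"
          using e[OF m0] e[OF m(1)] by blast+
        then show ?thesis by (simp add: in_keys_iff)
      next
        case False
        then have "Poly_Mapping.lookup a v = 0" "Poly_Mapping.lookup k v = 0"
          using aV kV by (auto simp: in_keys_iff)
        then show ?thesis using arg_cong[OF a(2), of "\<lambda>x. Poly_Mapping.lookup x v"]
          by (simp add: lookup_add)
      qed
      then have "e m0 = e m" by (rule poly_mapping_eqI)
      with inj m m0 show False by (auto dest: inj_onD)
    qed
    then have "(\<Sum>m\<in>S. Poly_Mapping.lookup (p m * Poly_Mapping.single (e m) 1) (k + e m0)) =
        Poly_Mapping.lookup (p m0 * Poly_Mapping.single (e m0) 1) (k + e m0)"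
      using \<open>finite S\<close> m0 by (subst sum.remove[of S m0]) auto
    then show ?thesis
      using arg_cong[OF sum0, of "\<lambda>x. Poly_Mapping.lookup x (k + e m0)"]
      by (simp add: lookup_sum lookup_mult_single)
  qed (simp add: in_keys_iff)
  then have "p m0 = 0" by (intro poly_mapping_eqI) simp
  with cp[OF m0] have "c m0 * Fract D 1 = 0" by (simp add: fract_collapse)
  moreover from D have "Fract D 1 \<noteq> 0" by (simp add: Zero_fract_def eq_fract)
  ultimately show ?thesis by simp
qed

lemma indet_power_notin:
  assumes "v \<notin> V" "n > 0"
  shows "(indet v :: ('v::linorder, 'k::field) ratfun) ^ n \<notin> ratfuns_in V"
proof
  assume in_V: "(indet v :: ('v, 'k) ratfun) ^ n \<in> ratfuns_in V"
  \<comment> \<open>The trivial relation v^n * 1 - 1 * v^n = 0, with the first v^n read as a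
    coefficient over \<open>V\<close> and the second as a monomial, contradicts
    independence.\<close>
  let ?c = "\<lambda>b. if b then indet v ^ n else (- 1 :: ('v, 'k) ratfun)"
  let ?e = "\<lambda>b. if b then 0 else Poly_Mapping.single v n"
  have "?c False = 0"
  proof (rule monomials_independent[of UNIV ?c V ?e])
    show "inj_on ?e UNIV"
      using \<open>n > 0\<close> by (auto simp: inj_on_def dest: arg_cong[of _ _ "\<lambda>m. Poly_Mapping.lookup m v"])
  qed (use in_V assms in \<open>auto simp: UNIV_bool mono_ratfun_0 indet_power[symmetric]
         intro!: ratfuns_in_uminus ratfuns_in_1\<close>)
  then show False by simp
qed

lemma indet_nonzero: "indet v \<noteq> 0"
  by (metis empty_iff indet_power_notin less_numeral_extra(1) power_one_right ratfuns_in_0)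


section \<open>Injective substitutions\<close>

text \<open>Monomials go to nonzero multiples of monomials in variables outside \<open>V\<close>,
  distinct ones to distinct ones because \<open>\<pi>\<close> is injective. The multipliers lie over
  \<open>V\<close>, so independence excludes cancellation.\<close>

lemma mpoly_subst_nonzero:
  fixes \<sigma> :: "'v::linorder \<Rightarrow> ('v, 'k::field) ratfun"
  assumes \<sigma>: "\<And>v. \<sigma> v = c v * indet (\<pi> v)" and c: "\<And>v. c v \<in> ratfuns_in V" "\<And>v. c v \<noteq> 0"
    and \<pi>: "inj \<pi>" "\<And>v. \<pi> v \<notin> V" and "q \<noteq> 0"
  shows "mpoly_subst \<sigma> q \<noteq> 0"
proof
  assume zero: "mpoly_subst \<sigma> q = 0"
  \<comment> \<open>\<open>\<mu> m\<close> is \<open>m\<close> with its variables renamed along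
    \<open>\<pi>\<close>; \<open>d m\<close> collects the coefficient of \<open>m\<close> in
    \<open>q\<close> and the factors \<open>c v\<close>.\<close>
  define \<mu> where
    "\<mu> m = (\<Sum>v\<in>Poly_Mapping.keys m. Poly_Mapping.single (\<pi> v) (Poly_Mapping.lookup m v))"
    for m :: "'v \<Rightarrow>\<^sub>0 nat"
  define d where "d m = const_ratfun (Poly_Mapping.lookup q m) *
    (\<Prod>v\<in>Poly_Mapping.keys m. c v ^ Poly_Mapping.lookup m v)" for m
  have lookup_\<mu>: "Poly_Mapping.lookup (\<mu> m) (\<pi> v) = Poly_Mapping.lookup m v" for m v
    using \<pi>(1) by (auto simp: \<mu>_def lookup_sum lookup_single inj_eq when_def in_keys_iff)
  have subst: "mpoly_subst \<sigma> q = (\<Sum>m\<in>Poly_Mapping.keys q. d m * mono_ratfun (\<mu> m))"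
    by (simp add: mpoly_subst_def \<sigma> d_def \<mu>_def power_mult_distrib prod.distrib indet_power
        mono_ratfun_sum mult_ac)
  from \<open>q \<noteq> 0\<close> obtain m0 where m0: "m0 \<in> Poly_Mapping.keys q" by (metis all_not_in_conv keys_eq_empty)
  have "d m0 = 0"
  proof (rule monomials_independent[of "Poly_Mapping.keys q" d V \<mu>])
    show "d m \<in> ratfuns_in V" for m
      unfolding d_def const_ratfun_def
      by (intro ratfuns_in_mult ratfuns_in_prod ratfuns_in_power c ratfuns_inI
          order_trans[OF mpoly_vars_single]) (auto simp: mpoly_vars_1)
    show "Poly_Mapping.keys (\<mu> m) \<inter> V = {}" for m
      using keys_sum[of "\<lambda>v. Poly_Mapping.single (\<pi> v) (Poly_Mapping.lookup m v)" "Poly_Mapping.keys m"] \<pi>(2)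
      by (fastforce simp: \<mu>_def split: if_splits)
    show "inj_on \<mu> (Poly_Mapping.keys q)"
      by (rule inj_onI) (metis lookup_\<mu> poly_mapping_eqI)
  qed (use zero subst m0 in auto)
  moreover have "const_ratfun (Poly_Mapping.lookup q m0) \<noteq> (0 :: ('v, 'k) ratfun)"
    using m0 by (auto simp: const_ratfun_def Zero_fract_def eq_fract in_keys_iff
        dest: arg_cong[of _ _ "\<lambda>p. Poly_Mapping.lookup p 0"])
  ultimately show False using c(2) by (simp add: d_def)
qed

text \<open>No denominator is sent to zero, so \<open>ratfun_subst \<sigma>\<close> is a
  homomorphism of the whole field.\<close>

locale injective_subst =
  fixes \<sigma> :: "'v::linorder \<Rightarrow> ('v, 'k::field) ratfun"
  assumes subst_nonzero: "q \<noteq> 0 \<Longrightarrow> mpoly_subst \<sigma> q \<noteq> 0"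
begin

lemma subst_mult: "ratfun_subst \<sigma> (f * g) = ratfun_subst \<sigma> f * ratfun_subst \<sigma> g"
  by (cases f; cases g) (simp add: ratfun_subst_Fract subst_nonzero mpoly_subst_mult)

lemma subst_add: "ratfun_subst \<sigma> (f + g) = ratfun_subst \<sigma> f + ratfun_subst \<sigma> g"
  by (cases f; cases g)
    (simp add: ratfun_subst_Fract subst_nonzero mpoly_subst_mult mpoly_subst_add field_simps)

lemma subst_1: "ratfun_subst \<sigma> 1 = 1"
  by (simp add: One_fract_def ratfun_subst_Fract subst_nonzero)

lemma subst_0: "ratfun_subst \<sigma> 0 = 0"
  using subst_add[of 0 0] by (metis add_cancel_left_left add_0)

lemma subst_diff: "ratfun_subst \<sigma> (f - g) = ratfun_subst \<sigma> f - ratfun_subst \<sigma> g"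
  using subst_add[of "f - g" g] by (simp add: algebra_simps)

lemma subst_inverse: "ratfun_subst \<sigma> (inverse f) = inverse (ratfun_subst \<sigma> f)"
proof (cases "f = 0")
  case False
  then have "ratfun_subst \<sigma> f * ratfun_subst \<sigma> (inverse f) = 1"
    by (simp flip: subst_mult add: subst_1)
  then show ?thesis by (rule inverse_unique[symmetric])
qed (simp add: subst_0)

lemma subst_divide: "ratfun_subst \<sigma> (f / g) = ratfun_subst \<sigma> f / ratfun_subst \<sigma> g"
  by (simp add: divide_inverse subst_mult subst_inverse)

lemma subst_power: "ratfun_subst \<sigma> (f ^ n) = ratfun_subst \<sigma> f ^ n"
  by (induction n) (simp_all add: subst_1 subst_mult)

lemma subst_prod: "ratfun_subst \<sigma> (\<Prod>x\<in>A. f x) = (\<Prod>x\<in>A. ratfun_subst \<sigma> (f x))"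
  by (induction A rule: infinite_finite_induct) (simp_all add: subst_1 subst_mult)

lemma subst_indet: "ratfun_subst \<sigma> (indet v) = \<sigma> v"
proof -
  have "mpoly_subst \<sigma> 1 = 1"
    using mpoly_subst_mult[of \<sigma> 1 1] subst_nonzero[of 1] by simp
  moreover have "const_ratfun 1 = (1 :: ('v, 'k) ratfun)"
    by (simp add: const_ratfun_def One_fract_def)
  ultimately show ?thesis by (simp add: indet_def ratfun_subst_Fract mpoly_subst_single)
qed

end

lemma mpoly_subst_cong:
  assumes "\<And>v. v \<in> mpoly_vars p \<Longrightarrow> \<sigma> v = \<tau> v"
  shows "mpoly_subst \<sigma> p = mpoly_subst \<tau> p"
  unfolding mpoly_subst_def
  using assms by (intro sum.cong prod.cong arg_cong2[of _ _ _ _ "(*)"]) (force simp: mpoly_vars_def)+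

text \<open>A presentation of \<open>f\<close> in the variables of \<open>V\<close> has the same
  image under both substitutions; in particular its denominator stays nonzero under
  \<open>\<tau>\<close>.\<close>

lemma (in injective_subst) subst_cong:
  assumes "f \<in> ratfuns_in V" and agree: "\<And>v. v \<in> V \<Longrightarrow> \<tau> v = \<sigma> v"
  shows "ratfun_subst \<tau> f = ratfun_subst \<sigma> f"
proof -
  obtain p q where f: "f = Fract p q" "q \<noteq> 0" "mpoly_vars p \<subseteq> V" "mpoly_vars q \<subseteq> V"
    using assms(1) by (elim ratfuns_inE)
  have "mpoly_subst \<tau> p = mpoly_subst \<sigma> p" "mpoly_subst \<tau> q = mpoly_subst \<sigma> q"
    using f agree by (auto intro!: mpoly_subst_cong)
  then show ?thesis by (simp add: f(1) ratfun_subst_Fract subst_nonzero f(2))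
qed

section \<open>The initial members of the Q-system\<close>

locale nonsimply_laced =
  fixes X :: nsl_type
  assumes valid: "valid_type X"
begin

definition d :: nat where
  "d = t_root X (short_root X)"

lemma d_ge_2: "d \<ge> 2"
  using valid unfolding d_def by (cases X) auto

lemma t_root_short: "t_root X (short_root X) = d"
  by (simp add: d_def)

lemma t_root_long: "t_root X (long_root X) = 1"
  using valid by (cases X) auto

lemma t_root_cases: "\<alpha> \<in> simple_roots X \<Longrightarrow> t_root X \<alpha> = 1 \<or> t_root X \<alpha> = d"
  unfolding d_def by (cases X) (auto simp: simple_roots_def)

lemma t_root_bounds: "\<alpha> \<in> simple_roots X \<Longrightarrow> 1 \<le> t_root X \<alpha> \<and> t_root X \<alpha> \<le> d"
  using t_root_cases[of \<alpha>] d_ge_2 by auto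

lemma long_root: "long_root X \<in> simple_roots X"
  and short_root: "short_root X \<in> simple_roots X"
  using valid by (cases X; auto simp: simple_roots_def)+

lemma adjacent_long_short: "adjacent X (long_root X) (short_root X)"
  using valid by (cases X) (auto simp: simple_roots_def adjacent_def)

lemma adjacentD:
  "adjacent X \<alpha> \<beta> \<Longrightarrow> \<alpha> \<in> simple_roots X \<and> \<beta> \<in> simple_roots X \<and> \<alpha> \<noteq> \<beta>"
  by (auto simp: adjacent_def)

lemma finite_adjacent: "finite {\<beta>. adjacent X \<alpha> \<beta>}"
  by (rule finite_subset[of _ "simple_roots X"]) (auto simp: adjacent_def simple_roots_def)

lemma adjacent_different_length:
  "adjacent X \<alpha> \<beta> \<Longrightarrow> t_root X \<alpha> \<noteq> t_root X \<beta> \<Longrightarrow>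
    \<alpha> = long_root X \<and> \<beta> = short_root X \<or> \<alpha> = short_root X \<and> \<beta> = long_root X"
  by (cases X) (auto simp: simple_roots_def adjacent_def split: if_splits)

lemma T_fun_same: "t_root X \<alpha> = t_root X \<beta> \<Longrightarrow> T_fun X Q \<alpha> \<beta> i = Q \<beta> i"
  by (simp add: T_fun_def)

lemma T_fun_long: "T_fun X Q (long_root X) (short_root X) i = Q (short_root X) (d * i)"
  using d_ge_2 by (simp add: T_fun_def t_root_long t_root_short)

lemma T_fun_short: "T_fun X Q (short_root X) (long_root X) i =
    indet (Var_a i) ^ nat ((- int i) mod int d) * (\<Prod>s = 0..d - 1. Q (long_root X) ((i + s) div d))"
proof -
  have "t_root X (short_root X) \<noteq> t_root X (long_root X)" "short_root X \<noteq> long_root X"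
    using d_ge_2 t_root_long t_root_short by auto
  then show ?thesis by (simp add: T_fun_def Let_def t_root_short)
qed

lemma adjacent_cases [consumes 1, case_names same long short]:
  assumes "adjacent X \<alpha> \<beta>"
  obtains "t_root X \<alpha> = t_root X \<beta>"
  | "\<alpha> = long_root X" "\<beta> = short_root X"
  | "\<alpha> = short_root X" "\<beta> = long_root X"
  using adjacent_different_length[OF assms] by blast

text \<open>The convention \<open>u\<^bsub>\<alpha>,0\<^esub> = u\<^sub>\<alpha>\<close> makes \<open>Q\<^bsub>\<alpha>,i+1\<^esub>\<close> a multiple of \<open>1 / u\<^bsub>\<alpha>,i\<^esub>\<close> for all \<open>i\<close>.\<close>

definition uvar :: "nat \<Rightarrow> nat \<Rightarrow> var" where
  "uvar \<alpha> j = (if j = 0 then Var_u \<alpha> else Var_uj \<alpha> j)"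

lemma uvar_eq_iff: "uvar \<alpha> i = uvar \<beta> j \<longleftrightarrow> \<alpha> = \<beta> \<and> i = j"
  by (auto simp: uvar_def)

text \<open>A set containing the variables of \<open>Q\<^bsub>\<alpha>,n\<^esub>\<close> for short \<open>\<alpha>\<close> and \<open>n \<le> d\<close>.\<close>

definition vars_upto :: "nat \<Rightarrow> var set" where
  "vars_upto n = {uvar \<beta> j | \<beta> j. \<beta> \<in> simple_roots X \<and> j < n \<and> j < t_root X \<beta>} \<union>
     {uvar \<beta> 0 | \<beta>. \<beta> \<in> simple_roots X \<and> t_root X \<beta> = 1} \<union> {Var_a j | j. 1 \<le> j \<and> j \<le> n \<and> j < d}"

lemma vars_upto_mono: "m \<le> n \<Longrightarrow> vars_upto m \<subseteq> vars_upto n"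
  unfolding vars_upto_def by fastforce

lemma uvar_in_vars_upto:
  "uvar \<alpha> j \<in> vars_upto n \<longleftrightarrow>
    \<alpha> \<in> simple_roots X \<and> (j < n \<and> j < t_root X \<alpha> \<or> j = 0 \<and> t_root X \<alpha> = 1)"
  by (auto simp: vars_upto_def uvar_eq_iff) (auto simp: uvar_def split: if_splits)

lemma Var_a_in_vars_upto: "Var_a j \<in> vars_upto n \<longleftrightarrow> 1 \<le> j \<and> j \<le> n \<and> j < d"
  by (auto simp: vars_upto_def uvar_def)

end

section \<open>Variables and nonvanishing of the initial members\<close>

locale Q_initial_family = nonsimply_laced X for X +
  fixes Q :: "'k::field family"
  assumes init: "Q_initial X Q"
begin

lemma Q_0: "\<alpha> \<in> simple_roots X \<Longrightarrow> Q \<alpha> 0 = 1"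
  and Q_1: "\<alpha> \<in> simple_roots X \<Longrightarrow> Q \<alpha> (Suc 0) = 1 / indet (uvar \<alpha> 0)"
  using init by (simp_all add: Q_initial_def uvar_def divide_inverse)

lemma Q_Suc:
  assumes "\<alpha> \<in> simple_roots X" "n < t_root X \<alpha>"
  shows "Q \<alpha> (Suc (Suc n)) =
    ((Q \<alpha> (Suc n))\<^sup>2 - (\<Prod>\<beta> | adjacent X \<alpha> \<beta>. T_fun X Q \<alpha> \<beta> (Suc n))) /
    (indet (uvar \<alpha> (Suc n)) * Q \<alpha> n)"
proof -
  have "Q_relation X Q \<alpha> (Suc n)" using init assms by (auto simp: Q_initial_def)
  then show ?thesis by (simp add: Q_relation_def uvar_def)
qed

text \<open>Otherwise the square of \<open>indet v\<close> would be x^2 / P, a rational function in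
  \<open>W\<close>, although \<open>v\<close> is not in \<open>W\<close>.\<close>

lemma square_minus_nonzero:
  fixes x P :: "(var, 'k) ratfun"
  assumes "x \<in> ratfuns_in W" "x \<noteq> 0" "P \<in> ratfuns_in W" "v \<notin> W"
  shows "(x / indet v)\<^sup>2 - P \<noteq> 0"
proof
  assume "(x / indet v)\<^sup>2 - P = 0"
  then have P: "P = x\<^sup>2 / (indet v)\<^sup>2" by (simp add: power_divide)
  then have "(indet v)\<^sup>2 = x\<^sup>2 / P" using \<open>x \<noteq> 0\<close> by (simp add: indet_nonzero)
  moreover have "x\<^sup>2 / P \<in> ratfuns_in W" using assms by (intro ratfuns_in_divide ratfuns_in_power)
  ultimately show False using indet_power_notin[OF assms(4), of 2] by (metis zero_less_numeral)
qed

text \<open>Induction for all short roots at once. The square of the current member has the factor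
  \<open>uvar \<alpha> n\<close> squared in its denominator, while the product over the neighbours
  avoids this variable: short neighbours bring in \<open>uvar \<beta> n\<close> instead, and the
  long one only its first two members and a power of \<open>Var_a (Suc n)\<close>. Hence the next
  numerator is nonzero.\<close>

lemma short_initial:
  assumes "n \<le> d" "\<alpha> \<in> simple_roots X" "t_root X \<alpha> = d"
  shows "Q \<alpha> n \<in> ratfuns_in (vars_upto n) \<and> Q \<alpha> n \<noteq> 0 \<and>
    (\<exists>x\<in>ratfuns_in (vars_upto n). x \<noteq> 0 \<and> Q \<alpha> (Suc n) = x / indet (uvar \<alpha> n))"
  using assms
proof (induction n arbitrary: \<alpha>)
  case 0
  then show ?case by (auto simp: Q_0 Q_1 ratfuns_in_1 intro!: bexI[of _ 1])
next
  case (Suc n)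
  let ?F = "vars_upto (Suc n)" and ?W = "vars_upto (Suc n) - {uvar \<alpha> n}"
  let ?P = "\<Prod>\<beta> | adjacent X \<alpha> \<beta>. T_fun X Q \<alpha> \<beta> (Suc n)"
  have n: "n < d" using Suc.prems by simp
  \<comment> \<open>\<open>uvar \<alpha> n\<close> is new at stage \<open>Suc n\<close>: the
    variables present at every stage belong to long roots, and \<open>\<alpha>\<close> is
    short.\<close>
  have sub: "vars_upto n \<subseteq> ?W"
    using vars_upto_mono[of n "Suc n"] d_ge_2 Suc.prems by (auto simp: uvar_in_vars_upto)
  from Suc obtain x where x: "x \<in> ratfuns_in (vars_upto n)" "x \<noteq> 0"
    and Qx: "Q \<alpha> (Suc n) = x / indet (uvar \<alpha> n)" by force
  have Qn: "Q \<alpha> n \<in> ratfuns_in ?W" "Q \<alpha> n \<noteq> 0"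
    using Suc sub by (auto intro: ratfuns_in_mono)
  have xW: "x \<in> ratfuns_in ?W" using x sub by (auto intro: ratfuns_in_mono)
  have T: "T_fun X Q \<alpha> \<beta> (Suc n) \<in> ratfuns_in ?W" if adj: "adjacent X \<alpha> \<beta>" for \<beta>
    using adj
  proof (cases rule: adjacent_cases)
    case same
    have \<beta>: "\<beta> \<in> simple_roots X" "\<beta> \<noteq> \<alpha>" "t_root X \<beta> = d"
      using adjacentD[OF adj] same Suc.prems by auto
    with Suc.IH[of \<beta>] n obtain y where y: "y \<in> ratfuns_in (vars_upto n)"
      and Qy: "Q \<beta> (Suc n) = y / indet (uvar \<beta> n)" by force
    have "uvar \<beta> n \<in> ?W" using \<beta> n by (simp add: uvar_in_vars_upto uvar_eq_iff)
    with y sub show ?thesis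
      by (auto simp: T_fun_same[OF same] Qy intro!: ratfuns_in_divide ratfuns_in_indet
          intro: ratfuns_in_mono)
  next
    case long
    then show ?thesis using Suc.prems t_root_long d_ge_2 by simp
  next
    case short
    have "\<alpha> \<noteq> long_root X" using Suc.prems t_root_long d_ge_2 by auto
    then have "uvar (long_root X) 0 \<in> ?W"
      using long_root t_root_long by (simp add: uvar_in_vars_upto uvar_eq_iff)
    then have Q_long: "Q (long_root X) (Suc 0) \<in> ratfuns_in ?W" "Q (long_root X) 0 \<in> ratfuns_in ?W"
      by (simp_all add: Q_0 Q_1 long_root ratfuns_in_1 ratfuns_in_divide ratfuns_in_indet)
    \<comment> \<open>Only the members of the long root with index 0 and 1 occur, and these are
      explicit.\<close>
    have "(Suc n + s) div d = 0 \<or> (Suc n + s) div d = Suc 0" if "s \<le> d - 1" for s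
    proof -
      have "Suc n + s < 2 * d" using that n by linarith
      then have "(Suc n + s) div d < 2" by (simp add: less_mult_imp_div_less)
      then show ?thesis by linarith
    qed
    then have "(\<Prod>s = 0..d - 1. Q (long_root X) ((Suc n + s) div d)) \<in> ratfuns_in ?W"
      using Q_long by (intro ratfuns_in_prod) (metis atLeastAtMost_iff)
    \<comment> \<open>For \<open>Suc n = d\<close> the exponent is 0, so the variable with index
      \<open>d\<close> never enters.\<close>
    moreover have "indet (Var_a (Suc n)) ^ nat ((- int (Suc n)) mod int d) \<in> ratfuns_in ?W"
    proof (cases "Suc n = d")
      case False
      then have "Var_a (Suc n) \<in> ?W" using n by (simp add: Var_a_in_vars_upto uvar_def)
      then show ?thesis by (intro ratfuns_in_power ratfuns_in_indet)
    qed (simp add: ratfuns_in_1)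
    ultimately show ?thesis unfolding short T_fun_short by (rule ratfuns_in_mult[rotated])
  qed
  have P: "?P \<in> ratfuns_in ?W" by (rule ratfuns_in_prod) (use T in simp)
  have "Q \<alpha> (Suc n) \<in> ratfuns_in ?F"
    unfolding Qx using x Suc.prems n
    by (intro ratfuns_in_divide ratfuns_in_indet)
      (auto simp: uvar_in_vars_upto intro: ratfuns_in_mono[OF _ vars_upto_mono[of n "Suc n"]])
  moreover have "Q \<alpha> (Suc n) \<noteq> 0" using x by (simp add: Qx indet_nonzero)
  moreover have "((Q \<alpha> (Suc n))\<^sup>2 - ?P) / Q \<alpha> n \<in> ratfuns_in ?F"
    using calculation(1) Qn P
    by (intro ratfuns_in_diff ratfuns_in_power ratfuns_in_divide) (auto intro: ratfuns_in_mono)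
  moreover have "((Q \<alpha> (Suc n))\<^sup>2 - ?P) / Q \<alpha> n \<noteq> 0"
    using square_minus_nonzero[OF xW \<open>x \<noteq> 0\<close> P, of "uvar \<alpha> n"] Qn by (simp add: Qx)
  moreover have "Q \<alpha> (Suc (Suc n)) = (((Q \<alpha> (Suc n))\<^sup>2 - ?P) / Q \<alpha> n) / indet (uvar \<alpha> (Suc n))"
    using Q_Suc[of \<alpha> n] Suc.prems n by (simp add: mult.commute)
  ultimately show ?case by blast
qed

text \<open>Away from the long root with a short neighbour, the term 1 / u^2 is the only one
  containing u = \<open>uvar \<alpha> 0\<close>. At that root the product may contain u too, and the
  last variable of the short neighbour's member of index \<open>d\<close> separates the terms
  instead.\<close>

lemma long_initial:
  assumes \<alpha>: "\<alpha> \<in> simple_roots X" "t_root X \<alpha> = 1"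
  shows "\<exists>x\<in>ratfuns_in (vars_upto d). x \<noteq> 0 \<and> Q \<alpha> 2 = x / indet (uvar \<alpha> 1)"
proof -
  let ?P = "\<Prod>\<beta> | adjacent X \<alpha> \<beta>. T_fun X Q \<alpha> \<beta> (Suc 0)"
  let ?x = "(1 / indet (uvar \<alpha> 0))\<^sup>2 - ?P"
  have Q1: "Q \<beta> (Suc 0) \<in> ratfuns_in W"
    if "\<beta> \<in> simple_roots X" "uvar \<beta> 0 \<in> W" for \<beta> W
    using that by (simp add: Q_1 ratfuns_in_1 ratfuns_in_divide ratfuns_in_indet)
  have same_length: "t_root X \<beta> = 1 \<and> T_fun X Q \<alpha> \<beta> (Suc 0) = Q \<beta> (Suc 0)"
    if "adjacent X \<alpha> \<beta>" "\<alpha> \<noteq> long_root X \<or> \<beta> \<noteq> short_root X" for \<beta>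
  proof -
    have "t_root X \<alpha> = t_root X \<beta>"
      using adjacent_different_length[OF that(1)] that(2) \<alpha> t_root_short d_ge_2
      by (metis numeral_le_one_iff semiring_norm(69))
    then show ?thesis using \<alpha> T_fun_same by simp
  qed
  have Q_short: "Q (short_root X) d \<in> ratfuns_in (vars_upto d)"
    using short_initial[of d "short_root X"] short_root t_root_short by simp
  have "?P \<in> ratfuns_in (vars_upto d)"
  proof (intro ratfuns_in_prod, clarify)
    fix \<beta> assume adj: "adjacent X \<alpha> \<beta>"
    show "T_fun X Q \<alpha> \<beta> (Suc 0) \<in> ratfuns_in (vars_upto d)"
    proof (cases "\<alpha> = long_root X \<and> \<beta> = short_root X")
      case True
      then show ?thesis using Q_short T_fun_long[of Q "Suc 0"] by simp
    next
      case False
      then show ?thesis using same_length[OF adj] adjacentD[OF adj]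
        by (auto intro!: Q1 simp: uvar_in_vars_upto)
    qed
  qed
  moreover have "uvar \<alpha> 0 \<in> vars_upto d" using \<alpha> by (simp add: uvar_in_vars_upto)
  ultimately have x: "?x \<in> ratfuns_in (vars_upto d)"
    by (intro ratfuns_in_diff ratfuns_in_power ratfuns_in_divide ratfuns_in_1 ratfuns_in_indet)
  have nz: "?x \<noteq> 0"
  proof (cases "\<alpha> = long_root X")
    case False
    have "?P \<in> ratfuns_in (- {uvar \<alpha> 0})"
    proof (intro ratfuns_in_prod, clarify)
      fix \<beta> assume adj: "adjacent X \<alpha> \<beta>"
      show "T_fun X Q \<alpha> \<beta> (Suc 0) \<in> ratfuns_in (- {uvar \<alpha> 0})"
        using same_length[OF adj] False adjacentD[OF adj] by (auto intro!: Q1 simp: uvar_eq_iff)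
    qed
    then show ?thesis by (intro square_minus_nonzero[OF ratfuns_in_1]) auto
  next
    case True
    \<comment> \<open>By \<open>short_initial\<close>, the member of the short root with index
      \<open>d\<close> is a nonzero multiple of 1 / \<open>indet v\<close>; neither the multiplier
      nor the other factors contain \<open>v\<close>.\<close>
    define v where "v = uvar (short_root X) (d - 1)"
    have ne: "long_root X \<noteq> short_root X"
      using t_root_long t_root_short d_ge_2 by auto
    obtain y where y: "y \<in> ratfuns_in (vars_upto (d - 1))" "y \<noteq> 0"
      and Qy: "Q (short_root X) d = y / indet v"
      using short_initial[of "d - 1" "short_root X"] short_root t_root_short d_ge_2
      by (auto simp: v_def)
    have yW: "y \<in> ratfuns_in (- {v})"
      using y(1) d_ge_2 by (rule_tac ratfuns_in_mono) (auto simp: v_def uvar_in_vars_upto t_root_short)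
    define P' where "P' = (\<Prod>\<beta>\<in>{\<beta>. adjacent X \<alpha> \<beta>} - {short_root X}. T_fun X Q \<alpha> \<beta> (Suc 0))"
    have P'W: "P' \<in> ratfuns_in (- {v})"
      unfolding P'_def
    proof (rule ratfuns_in_prod)
      fix \<beta> assume "\<beta> \<in> {\<beta>. adjacent X \<alpha> \<beta>} - {short_root X}"
      then have adj: "adjacent X \<alpha> \<beta>" and "\<beta> \<noteq> short_root X" by auto
      then show "T_fun X Q \<alpha> \<beta> (Suc 0) \<in> ratfuns_in (- {v})"
        using same_length[OF adj] adjacentD[OF adj]
        by (auto intro!: Q1 simp: v_def uvar_eq_iff)
    qed
    have "?P = T_fun X Q \<alpha> (short_root X) (Suc 0) * P'"
      unfolding P'_def using finite_adjacent[of \<alpha>] adjacent_long_short True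
      by (intro prod.remove) auto
    then have P: "?P = y / indet v * P'" using True T_fun_long[of Q "Suc 0"] Qy by simp
    show ?thesis
    proof
      assume "?x = 0"
      \<comment> \<open>Solving \<open>?x = 0\<close> for \<open>indet v\<close> expresses it
        through functions free of \<open>v\<close>.\<close>
      then have "indet v ^ 1 = y * P' * (indet (uvar \<alpha> 0))\<^sup>2"
        using P by (simp add: field_simps indet_nonzero)
      moreover have "\<dots> \<in> ratfuns_in (- {v})"
        using True ne by (intro ratfuns_in_mult yW P'W ratfuns_in_power ratfuns_in_indet)
          (simp add: v_def uvar_eq_iff)
      moreover have "indet v ^ 1 \<notin> (ratfuns_in (- {v}) :: (var, 'k) ratfun set)"
        by (rule indet_power_notin) auto
      ultimately show False by simp
    qed
  qed
  have "Q \<alpha> 2 = ?x / indet (uvar \<alpha> 1)"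
    using Q_Suc[of \<alpha> 0] \<alpha> by (simp add: Q_0 Q_1 numeral_2_eq_2)
  with x nz show ?thesis by blast
qed

lemma initial_members:
  assumes "\<alpha> \<in> simple_roots X"
  shows "Q \<alpha> (t_root X \<alpha>) \<in> ratfuns_in (vars_upto d)" "Q \<alpha> (t_root X \<alpha>) \<noteq> 0"
    and "\<exists>x\<in>ratfuns_in (vars_upto d). x \<noteq> 0 \<and>
      Q \<alpha> (t_root X \<alpha> + 1) = x / indet (Var_uj \<alpha> (t_root X \<alpha>))"
proof -
  have u: "uvar \<alpha> (t_root X \<alpha>) = Var_uj \<alpha> (t_root X \<alpha>)"
    using t_root_bounds[OF assms] by (simp add: uvar_def)
  have "t_root X \<alpha> = 1 \<or> t_root X \<alpha> = d" by (rule t_root_cases[OF assms])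
  then have "Q \<alpha> (t_root X \<alpha>) \<in> ratfuns_in (vars_upto d) \<and> Q \<alpha> (t_root X \<alpha>) \<noteq> 0 \<and>
    (\<exists>x\<in>ratfuns_in (vars_upto d). x \<noteq> 0 \<and> Q \<alpha> (t_root X \<alpha> + 1) = x / indet (uvar \<alpha> (t_root X \<alpha>)))"
  proof
    assume t: "t_root X \<alpha> = 1"
    then have "Q \<alpha> 1 \<in> ratfuns_in (vars_upto d)"
      using assms by (auto simp: Q_1 uvar_in_vars_upto
          intro!: ratfuns_in_divide ratfuns_in_1 ratfuns_in_indet)
    moreover have "Q \<alpha> 1 \<noteq> 0" using assms by (simp add: Q_1 indet_nonzero)
    ultimately show ?thesis using long_initial[OF assms t] t by (simp add: numeral_2_eq_2)
  next
    assume "t_root X \<alpha> = d"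
    then show ?thesis using short_initial[OF order_refl assms] by simp
  qed
  then show "Q \<alpha> (t_root X \<alpha>) \<in> ratfuns_in (vars_upto d)" "Q \<alpha> (t_root X \<alpha>) \<noteq> 0"
    and "\<exists>x\<in>ratfuns_in (vars_upto d). x \<noteq> 0 \<and>
      Q \<alpha> (t_root X \<alpha> + 1) = x / indet (Var_uj \<alpha> (t_root X \<alpha>))"
    by (auto simp: u)
qed


section \<open>The shift of variables\<close>

text \<open>The surplus symbols are left alone, so that the shift is injective on all of them.\<close>

definition shift :: "var \<Rightarrow> (var, 'k) ratfun" where
  "shift v = (if v \<in> formal_vars X then shifted X Q v else indet v)"

lemma vars_upto_formal: "vars_upto n \<subseteq> formal_vars X"
  by (auto simp: vars_upto_def formal_vars_def uvar_def)

text \<open>The variable that \<open>shift v\<close> is a multiple of. \<open>Var_u \<alpha>\<close>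
  behaves like index 0, because 1 / \<open>Q \<alpha> (t_root X \<alpha> + 1)\<close> is a multiple
  of \<open>Var_uj \<alpha> (t_root X \<alpha>)\<close>.\<close>

definition shift_index :: "var \<Rightarrow> var" where
  "shift_index v =
     (if v \<in> formal_vars X then
        (case v of Var_u \<alpha> \<Rightarrow> Var_uj \<alpha> (t_root X \<alpha>) | Var_uj \<alpha> j \<Rightarrow> Var_uj \<alpha> (t_root X \<alpha> + j)
           | Var_a j \<Rightarrow> Var_a (j + d))
      else v)"

text \<open>This and the next two lemmas are the hypotheses of \<open>mpoly_subst_nonzero\<close>;
  the multipliers are controlled by \<open>initial_members\<close>.\<close>

lemma shift_triangular:
  "\<exists>c. shift v = c * indet (shift_index v) \<and> c \<in> ratfuns_in (vars_upto d) \<and> c \<noteq> 0"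
proof (cases "v \<in> formal_vars X")
  case False
  then show ?thesis by (auto simp: shift_def shift_index_def ratfuns_in_1 intro!: exI[of _ 1])
next
  case True
  show ?thesis
  proof (cases v)
    case (Var_u \<alpha>)
    with True have "\<alpha> \<in> simple_roots X" by (auto simp: formal_vars_def)
    from initial_members(3)[OF this] obtain x where x: "x \<in> ratfuns_in (vars_upto d)" "x \<noteq> 0"
      "Q \<alpha> (t_root X \<alpha> + 1) = x / indet (Var_uj \<alpha> (t_root X \<alpha>))" by blast
    then have "shift v = inverse x * indet (Var_uj \<alpha> (t_root X \<alpha>))"
      using True Var_u by (simp add: shift_def field_simps)
    then show ?thesis
      using x True Var_u by (auto simp: shift_index_def intro!: exI[of _ "inverse x"] ratfuns_in_inverse)
  next
    case (Var_uj \<alpha> j)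
    with True have "\<alpha> \<in> simple_roots X" by (auto simp: formal_vars_def)
    then show ?thesis
      using True Var_uj initial_members(1,2)[of \<alpha>]
      by (auto simp: shift_def shift_index_def intro!: exI[of _ "Q \<alpha> (t_root X \<alpha>) ^ of_bool (j = 1)"] ratfuns_in_power)
  next
    case (Var_a j)
    then show ?thesis
      using True initial_members(1,2)[OF long_root]
      by (auto simp: shift_def shift_index_def t_root_long t_root_short
          intro!: exI[of _ "Q (long_root X) 1 ^ of_bool (j < d)"] ratfuns_in_power)
  qed
qed

lemma shift_index_notin: "shift_index v \<notin> vars_upto d"
proof (cases "v \<in> formal_vars X")
  case True
  have "Var_uj \<alpha> k \<notin> vars_upto d" if "\<alpha> \<in> simple_roots X" "k \<ge> t_root X \<alpha>" for \<alpha> k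
  proof -
    have "k \<noteq> 0" using t_root_bounds[OF that(1)] that(2) by auto
    then have "Var_uj \<alpha> k = uvar \<alpha> k" by (simp add: uvar_def)
    then show ?thesis using that \<open>k \<noteq> 0\<close> by (simp add: uvar_in_vars_upto)
  qed
  then show ?thesis
    using True by (auto simp: shift_index_def formal_vars_def Var_a_in_vars_upto)
qed (use vars_upto_formal in \<open>auto simp: shift_index_def\<close>)

lemma inj_shift_index: "inj shift_index"
proof (rule injI)
  fix v w assume eq: "shift_index v = shift_index w"
  have t_pos: "Suc 0 \<le> t_root X \<alpha>" if "\<alpha> \<in> simple_roots X" for \<alpha>
    using t_root_bounds[OF that] by simp
  \<comment> \<open>Formal variables and surplus symbols cannot collide, so injectivity may be
    checked within each kind.\<close>
  have formal: "shift_index v \<in> formal_vars X \<longleftrightarrow> v \<in> formal_vars X" for v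
    by (cases v) (use t_pos in \<open>auto simp: shift_index_def formal_vars_def\<close>)
  show "v = w"
  proof (cases "v \<in> formal_vars X")
    case True
    then have "w \<in> formal_vars X" using formal eq by metis
    with True eq show ?thesis
      by (cases v; cases w) (simp_all add: shift_index_def formal_vars_def)
  next
    case False
    then have "w \<notin> formal_vars X" using formal eq by metis
    with False eq show ?thesis by (simp add: shift_index_def)
  qed
qed

sublocale shift: injective_subst shift
proof
  fix q :: "(var, 'k) mpoly" assume "q \<noteq> 0"
  obtain c where "\<And>v. shift v = c v * indet (shift_index v)"
    "\<And>v. c v \<in> ratfuns_in (vars_upto d)" "\<And>v. c v \<noteq> 0"
    using shift_triangular by metis
  then show "mpoly_subst shift q \<noteq> 0"
    using inj_shift_index shift_index_notin \<open>q \<noteq> 0\<close> by (rule mpoly_subst_nonzero)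
qed

lemma ratfun_subst_shifted:
  assumes "f \<in> ratfuns_in (formal_vars X)"
  shows "ratfun_subst (shifted X Q) f = ratfun_subst shift f"
  by (rule shift.subst_cong[OF assms]) (simp add: shift_def)

section \<open>Transport of the relations along the shift\<close>

text \<open>Every member of the family on the right-hand side of the relation for \<open>Q\<^bsub>\<alpha>,i+1\<^esub>\<close> has
  smaller measure than \<open>Q\<^bsub>\<alpha>,i+1\<^esub>\<close>, across roots of different lengths too.\<close>

definition meas :: "nat \<Rightarrow> nat \<Rightarrow> nat" where
  "meas \<beta> j = (if t_root X \<beta> = 1 then d * j + 1 else j + d)"

definition Q_rhs :: "nat \<Rightarrow> nat \<Rightarrow> (var, 'k) ratfun" where
  "Q_rhs \<alpha> i =
    ((Q \<alpha> i)\<^sup>2 - (\<Prod>\<beta> | adjacent X \<alpha> \<beta>. T_fun X Q \<alpha> \<beta> i)) / (indet (Var_uj \<alpha> i) * Q \<alpha> (i - 1))"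

text \<open>For equal lengths both indices move equally. From long to short, d * i + d = d * (i +
  1). From short to long, adding \<open>d\<close> raises each floor by 1; the factors with floor 0
  equal 1 and stay fixed, a defect compensated by the image of \<open>Var_a i\<close>.\<close>

lemma shift_T_fun:
  assumes adj: "adjacent X \<alpha> \<beta>" and "i \<ge> 1"
    and IH: "\<And>\<beta> j. \<beta> \<in> simple_roots X \<Longrightarrow> j \<ge> 1 \<Longrightarrow> meas \<beta> j < meas \<alpha> (i + 1) \<Longrightarrow>
      ratfun_subst shift (Q \<beta> j) = Q \<beta> (j + t_root X \<beta>)"
  shows "ratfun_subst shift (T_fun X Q \<alpha> \<beta> i) = T_fun X Q \<alpha> \<beta> (i + t_root X \<alpha>)"
  using adj
proof (cases rule: adjacent_cases)
  case same
  have "meas \<beta> i < meas \<alpha> (i + 1)" using same d_ge_2 by (simp add: meas_def)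
  then show ?thesis using adjacentD[OF adj] \<open>i \<ge> 1\<close> IH by (simp add: same T_fun_same)
next
  case long
  \<comment> \<open>The measures are d * i + d and d * (i + 1) + 1: the summand 1 for long roots in
    \<open>meas\<close> makes the inequality strict.\<close>
  have "meas \<beta> (d * i) < meas \<alpha> (i + 1)"
    using long d_ge_2 t_root_long t_root_short by (simp add: meas_def)
  moreover have "d * i \<ge> 1" using d_ge_2 \<open>i \<ge> 1\<close> by simp
  ultimately have "ratfun_subst shift (Q \<beta> (d * i)) = Q \<beta> (d * i + d)"
    using IH short_root long t_root_short by metis
  then show ?thesis using long t_root_long by (simp add: T_fun_long algebra_simps)
next
  case short
  let ?L = "long_root X"
  \<comment> \<open>The divisor records the exception at \<open>j = 0\<close>, where the member is 1
    and does not become the member of index 1.\<close>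
  have Q_shift: "ratfun_subst shift (Q ?L j) = Q ?L (j + 1) / Q ?L 1 ^ of_bool (j = 0)"
    if "d * j \<le> i + d - 1" for j
  proof (cases "j = 0")
    case True
    then show ?thesis using Q_0 Q_1 long_root by (simp add: shift.subst_1 indet_nonzero)
  next
    case False
    have "meas ?L j < meas \<alpha> (i + 1)"
      using that short d_ge_2 t_root_long t_root_short by (simp add: meas_def)
    then show ?thesis using IH[of ?L j] long_root False t_root_long by simp
  qed
  have dj: "d * ((i + s) div d) \<le> i + d - 1" if "s \<le> d - 1" for s
    using that d_ge_2 times_div_less_eq_dividend[of d "i + s"] by linarith
  have Q1: "Q ?L 1 \<noteq> 0" using initial_members(2)[OF long_root] t_root_long by simp
  \<comment> \<open>The new factors \<open>Q\<^bsub>\<gamma>,1\<^esub>\<close> of the shifted product, one for each \<open>s < d - i\<close>, are supplied by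
    \<open>a\<^sub>i'\<close>, whose exponent is \<open>d - i\<close> when \<open>i < d\<close>.\<close>
  let ?e = "nat ((- int i) mod int d)"
  have e: "nat ((- int (i + d)) mod int d) = ?e" by simp
  have "(\<Prod>s = 0..d - 1. ratfun_subst shift (Q ?L ((i + s) div d))) =
      (\<Prod>s = 0..d - 1. Q ?L ((i + d + s) div d) / Q ?L 1 ^ of_bool (i + s < d))"
  proof (rule prod.cong)
    fix s assume "s \<in> {0..d - 1}"
    then have "ratfun_subst shift (Q ?L ((i + s) div d)) =
        Q ?L ((i + s) div d + 1) / Q ?L 1 ^ of_bool ((i + s) div d = 0)"
      using Q_shift[OF dj] by simp
    moreover have "(i + s) div d = 0 \<longleftrightarrow> i + s < d" using d_ge_2 by (simp add: div_eq_0_iff)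
    moreover have "(i + s) div d + 1 = (i + d + s) div d"
      using d_ge_2 div_add_self2[of d "i + s"] by (simp add: add_ac)
    ultimately show "ratfun_subst shift (Q ?L ((i + s) div d)) =
        Q ?L ((i + d + s) div d) / Q ?L 1 ^ of_bool (i + s < d)" by simp
  qed simp
  also have "\<dots> = (\<Prod>s = 0..d - 1. Q ?L ((i + d + s) div d)) / (\<Prod>s = 0..d - 1. Q ?L 1 ^ of_bool (i + s < d))"
    by (rule prod_dividef)
  \<comment> \<open>The truncated difference is the right count also for \<open>i \<ge> d\<close>,
    where it is 0 and no factor is exceptional.\<close>
  also have "(\<Prod>s = 0..d - 1. Q ?L 1 ^ of_bool (i + s < d)) = Q ?L 1 ^ (d - i)"
  proof -
    have "(\<Prod>s = 0..d - 1. Q ?L 1 ^ of_bool (i + s < d)) = (\<Prod>s \<in> {0..<d - i}. Q ?L 1)"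
      using d_ge_2 by (intro prod.mono_neutral_cong_right) auto
    then show ?thesis by simp
  qed
  finally have prod: "(\<Prod>s = 0..d - 1. ratfun_subst shift (Q ?L ((i + s) div d))) =
      (\<Prod>s = 0..d - 1. Q ?L ((i + d + s) div d)) / Q ?L 1 ^ (d - i)" .
  have "shift (Var_a i) ^ ?e = Q ?L 1 ^ (d - i) * indet (Var_a (i + d)) ^ ?e"
  proof (cases "i < d")
    case True
    have "(- int i) mod int d = int d - int i"
      using True \<open>i \<ge> 1\<close> by (simp add: zmod_zminus1_eq_if)
    then have "?e = d - i" using True by simp
    then show ?thesis
      using True \<open>i \<ge> 1\<close> by (simp add: shift_def formal_vars_def t_root_short power_mult_distrib)
  next
    case False
    then show ?thesis using \<open>i \<ge> 1\<close> by (simp add: shift_def formal_vars_def t_root_short)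
  qed
  then show ?thesis
    unfolding short T_fun_short t_root_short e
    using Q1 by (simp add: shift.subst_mult shift.subst_power shift.subst_prod shift.subst_indet prod
        del: One_nat_def)
qed

lemma shift_Q_rhs:
  assumes \<alpha>: "\<alpha> \<in> simple_roots X" and "i \<ge> 1"
    and IH: "\<And>\<beta> j. \<beta> \<in> simple_roots X \<Longrightarrow> j \<ge> 1 \<Longrightarrow> meas \<beta> j < meas \<alpha> (i + 1) \<Longrightarrow>
      ratfun_subst shift (Q \<beta> j) = Q \<beta> (j + t_root X \<beta>)"
  shows "ratfun_subst shift (Q_rhs \<alpha> i) = Q_rhs \<alpha> (i + t_root X \<alpha>)"
proof -
  have meas: "meas \<alpha> j < meas \<alpha> (i + 1)" if "j \<le> i" for j
    using that d_ge_2 by (auto simp: meas_def intro: le_less_trans[of _ "d * i"])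
  have "ratfun_subst shift (indet (Var_uj \<alpha> i) * Q \<alpha> (i - 1)) =
      indet (Var_uj \<alpha> (i + t_root X \<alpha>)) * Q \<alpha> (i + t_root X \<alpha> - 1)"
  \<comment> \<open>For \<open>i = 1\<close> the factor \<open>Q \<alpha> 0 = 1\<close> is fixed,
    and the missing \<open>Q \<alpha> (t_root X \<alpha>)\<close> comes from the image of
    \<open>Var_uj \<alpha> 1\<close>.\<close>
  proof (cases "i = 1")
    case True
    then show ?thesis using \<alpha>
      by (simp add: shift.subst_mult shift.subst_indet shift.subst_1 Q_0 shift_def formal_vars_def add.commute)
  next
    case False
    then have "ratfun_subst shift (Q \<alpha> (i - 1)) = Q \<alpha> (i + t_root X \<alpha> - 1)"
      using IH[OF \<alpha>, of "i - 1"] meas[of "i - 1"] \<open>i \<ge> 1\<close> by simp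
    then show ?thesis using False \<alpha> \<open>i \<ge> 1\<close>
      by (simp add: shift.subst_mult shift.subst_indet shift_def formal_vars_def add.commute)
  qed
  moreover have "ratfun_subst shift (\<Prod>\<beta> | adjacent X \<alpha> \<beta>. T_fun X Q \<alpha> \<beta> i) =
      (\<Prod>\<beta> | adjacent X \<alpha> \<beta>. T_fun X Q \<alpha> \<beta> (i + t_root X \<alpha>))"
    unfolding shift.subst_prod
    by (rule prod.cong) (use shift_T_fun[OF _ \<open>i \<ge> 1\<close> IH] in auto)
  moreover have "ratfun_subst shift (Q \<alpha> i) = Q \<alpha> (i + t_root X \<alpha>)"
    using IH[OF \<alpha> \<open>i \<ge> 1\<close>] meas[of i] by simp
  ultimately show ?thesis
    by (simp only: Q_rhs_def shift.subst_divide shift.subst_diff shift.subst_power)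
qed

lemma Q_relation_iff: "Q_relation X Q \<alpha> i \<longleftrightarrow> Q \<alpha> (i + 1) = Q_rhs \<alpha> i"
  by (simp add: Q_relation_def Q_rhs_def)

text \<open>Induction on \<open>meas\<close>. For \<open>i = 1\<close> the claim is the choice of
  the image of \<open>Var_u \<alpha>\<close>; otherwise the relation producing
  \<open>Q \<alpha> i\<close> is carried to the one producing
  \<open>Q \<alpha> (i + t_root X \<alpha>)\<close>.\<close>

lemma Q_system_imp_shift:
  assumes "Q_system X Q" "\<alpha> \<in> simple_roots X" "i \<ge> 1"
  shows "ratfun_subst shift (Q \<alpha> i) = Q \<alpha> (i + t_root X \<alpha>)"
  using assms(2,3)
proof (induction "meas \<alpha> i" arbitrary: \<alpha> i rule: less_induct)
  case less
  show ?case
  proof (cases "i = 1")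
    case True
    have "ratfun_subst shift (Q \<alpha> 1) = inverse (shift (Var_u \<alpha>))"
      using less.prems by (simp add: Q_1 uvar_def shift.subst_inverse shift.subst_indet divide_inverse)
    then show ?thesis
      using True less.prems by (simp add: shift_def formal_vars_def divide_inverse)
  next
    case False
    define k where "k = i - 1"
    have k: "i = k + 1" "k \<ge> 1" using False less.prems by (auto simp: k_def)
    have rel: "Q \<alpha> (j + 1) = Q_rhs \<alpha> j" if "j \<ge> 1" for j
      unfolding Q_relation_iff[symmetric] using assms(1) less.prems that by (simp add: Q_system_def)
    have "ratfun_subst shift (Q_rhs \<alpha> k) = Q_rhs \<alpha> (k + t_root X \<alpha>)"
      using shift_Q_rhs[OF less.prems(1) k(2)] less.hyps k(1) by blast
    then show ?thesis using k rel[of k] rel[of "k + t_root X \<alpha>"] by (simp add: add_ac)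
  qed
qed

text \<open>The first \<open>t_root X \<alpha>\<close> relations are initial data; each later one is
  the image of the relation \<open>t_root X \<alpha>\<close> places before.\<close>

lemma shift_imp_Q_relation:
  assumes shift: "\<And>\<beta> j. \<beta> \<in> simple_roots X \<Longrightarrow> j \<ge> 1 \<Longrightarrow>
      ratfun_subst shift (Q \<beta> j) = Q \<beta> (j + t_root X \<beta>)"
    and \<alpha>: "\<alpha> \<in> simple_roots X" and "i \<ge> 1"
  shows "Q_relation X Q \<alpha> i"
  using \<open>i \<ge> 1\<close>
proof (induction i rule: less_induct)
  case (less i)
  show ?case
  proof (cases "i \<le> t_root X \<alpha>")
    case True
    then show ?thesis using init \<alpha> less.prems by (simp add: Q_initial_def)
  next
    case False
    define k where "k = i - t_root X \<alpha>"
    have k: "i = k + t_root X \<alpha>" "k \<ge> 1" "k < i"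
      using False t_root_bounds[OF \<alpha>] by (auto simp: k_def)
    have "Q \<alpha> (i + 1) = ratfun_subst shift (Q \<alpha> (k + 1))"
      using shift[OF \<alpha>, of "k + 1"] k(1) by (simp add: add_ac)
    also have "\<dots> = ratfun_subst shift (Q_rhs \<alpha> k)"
      using less.IH[OF k(3,2)] by (simp add: Q_relation_iff)
    also have "\<dots> = Q_rhs \<alpha> i"
      using shift_Q_rhs[OF \<alpha> k(2) shift] k(1) by simp
    finally show ?thesis by (simp add: Q_relation_iff)
  qed
qed

end

theorem lemma5p1:
  fixes X :: nsl_type and Q :: "nat \<Rightarrow> nat \<Rightarrow> (var, 'k::field_char_0) ratfun"
  assumes "valid_type X"
    and "\<And>\<alpha> i. \<alpha> \<in> simple_roots X \<Longrightarrow> Q \<alpha> i \<in> ratfuns_in (formal_vars X)"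
  shows "Q_system X Q \<longleftrightarrow> Q_initial X Q \<and> Q_recursion X Q"
proof (cases "Q_initial X Q")
  case True
  \<comment> \<open>Both sides contain the initial conditions, and these already make the shift
    injective.\<close>
  interpret Q_initial_family X Q by standard (use assms True in auto)
  have "Q_recursion X Q \<longleftrightarrow> (\<forall>\<alpha>\<in>simple_roots X. \<forall>i\<ge>1.
      ratfun_subst shift (Q \<alpha> i) = Q \<alpha> (i + t_root X \<alpha>))"
    using assms(2) by (auto simp: Q_recursion_def ratfun_subst_shifted)
  moreover have "Q_system X Q" if "\<forall>\<alpha>\<in>simple_roots X. \<forall>i\<ge>1.
      ratfun_subst shift (Q \<alpha> i) = Q \<alpha> (i + t_root X \<alpha>)"
    using True shift_imp_Q_relation that by (simp add: Q_system_def Q_initial_def)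
  ultimately show ?thesis using True Q_system_imp_shift by blast
qed (auto simp: Q_system_def Q_initial_def)

end
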